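(* Let $c$ be an admissible overlap function on a compact and totally disconnected space $X$. There is a locally finite rooted tree $T_c$ whose vertices at level $n$ are the classes of $\sim_n^c$, with adjacency given by containment of consecutive classes (a class of $\sim_{n+1}^c$ is adjacent to the class of $\sim_n^c$ containing it). The map $$\pi_c\colon X\longrightarrow\partial T_c,\qquad \xi\longmapsto\bigl([\xi]_{\sim_n^c}\bigr)_{n\geq0},$$ is a homeomorphism. If a group $G$ acts on $X$ and $c(g\xi,g\eta)=c(\xi,\eta)$ for all $g\in G$ (and all $\xi,\eta\in X$), then $G$ acts by rooted automorphisms on $T_c$, and the homeomorphism $\pi_c$ is $G$-equivariant.
   Context: $\mathbb N$ contains $0$. An overlap function on a set $X$ is a function $c\colon X\times X\to\mathbb N\cup\{\infty\}$ such that for all $\xi,\eta,\zeta\in X$: $c(\xi,\xi)=\infty$; $c(\xi,\eta)=c(\eta,\xi)$; $c(\xi,\zeta)\ge\min\{c(\xi,\eta),c(\eta,\zeta)\}$. For $n\geq 0$, $\sim_n^c$ is the equivalence relation on $X$ given by $\xi\sim_n^c\eta\iff c(\xi,\eta)\geq n$. If $X$ is compact and totally disconnected, $c$ is admissible if (i) every $\sim_n^c$ has finitely many equivalence classes, each of which is clopen, and (ii) $c(\xi,\eta)=\infty$ implies $\xi=\eta$. For a rooted tree $T$, level $n$ is the set of vertices at distance $n$ from the root, and $\partial T$ is the set of infinite non-backtracking rays starting at the root, with topology generated by the cylinders $\operatorname{Cyl}(v)$ (the rays through the vertex $v$). Vertices of $T_c$ at different levels are regarded as different even if they coincide as subsets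 of $X$. The action of $G$ on $T_c$ is $g[\xi]_{\sim_n^c}=[g\xi]_{\sim_n^c}$, and $G$ acts on $\partial T_c$ by the induced action. *)

theory Defs
  imports
    "HOL-Analysis.Abstract_Topology_2"
    "HOL-Library.Extended_Nat"
    "HOL-Algebra.Group_Action"
begin

section \<open>Overlap functions\<close>

definition overlap_function :: "'a set \<Rightarrow> ('a \<Rightarrow> 'a \<Rightarrow> enat) \<Rightarrow> bool" where
  "overlap_function S c \<longleftrightarrow>
     (\<forall>\<xi>\<in>S. c \<xi> \<xi> = \<infinity>) \<and>
     (\<forall>\<xi>\<in>S. \<forall>\<eta>\<in>S. c \<xi> \<eta> = c \<eta> \<xi>) \<and>
     (\<forall>\<xi>\<in>S. \<forall>\<eta>\<in>S. \<forall>\<zeta>\<in>S. min (c \<xi> \<eta>) (c \<eta> \<zeta>) \<le> c \<xi> \<zeta>)"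

definition overlap_rel :: "'a set \<Rightarrow> ('a \<Rightarrow> 'a \<Rightarrow> enat) \<Rightarrow> nat \<Rightarrow> 'a rel" where
  "overlap_rel S c n = {(\<xi>, \<eta>). \<xi> \<in> S \<and> \<eta> \<in> S \<and> enat n \<le> c \<xi> \<eta>}"

definition totally_disconnected_space :: "'a topology \<Rightarrow> bool" where
  "totally_disconnected_space X \<longleftrightarrow> (\<forall>S. connectedin X S \<longrightarrow> (\<exists>x. S \<subseteq> {x}))"

definition admissible :: "'a topology \<Rightarrow> ('a \<Rightarrow> 'a \<Rightarrow> enat) \<Rightarrow> bool" where
  "admissible X c \<longleftrightarrow>
     (\<forall>n. finite (topspace X // overlap_rel (topspace X) c n) \<and>
          (\<forall>C \<in> topspace X // overlap_rel (topspace X) c n. openin X C \<and> closedin X C)) \<and>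
     (\<forall>\<xi>\<in>topspace X. \<forall>\<eta>\<in>topspace X. c \<xi> \<eta> = \<infinity> \<longrightarrow> \<xi> = \<eta>)"


section \<open>Rooted trees and their boundaries\<close>

record 'v rooted_graph =
  verts :: "'v set"
  edges :: "'v set set"
  root_vertex :: 'v

abbreviation adjacent :: "'v rooted_graph \<Rightarrow> 'v \<Rightarrow> 'v \<Rightarrow> bool" where
  "adjacent T u v \<equiv> {u, v} \<in> edges T"

definition simple_graph :: "'v rooted_graph \<Rightarrow> bool" where
  "simple_graph T \<longleftrightarrow> (\<forall>e \<in> edges T. \<exists>u\<in>verts T. \<exists>v\<in>verts T. u \<noteq> v \<and> e = {u, v})"

definition walk :: "'v rooted_graph \<Rightarrow> 'v list \<Rightarrow> bool" where
  "walk T p \<longleftrightarrow> p \<noteq> [] \<and> set p \<subseteq> verts T \<and> successively (adjacent T) p"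

definition connected_graph :: "'v rooted_graph \<Rightarrow> bool" where
  "connected_graph T \<longleftrightarrow>
     (\<forall>u\<in>verts T. \<forall>v\<in>verts T. \<exists>p. walk T p \<and> hd p = u \<and> last p = v)"

definition graph_cycle :: "'v rooted_graph \<Rightarrow> 'v list \<Rightarrow> bool" where
  "graph_cycle T p \<longleftrightarrow>
     3 \<le> length p \<and> distinct p \<and> walk T p \<and> adjacent T (last p) (hd p)"

definition rooted_tree :: "'v rooted_graph \<Rightarrow> bool" where
  "rooted_tree T \<longleftrightarrow>
     simple_graph T \<and> root_vertex T \<in> verts T \<and>
     connected_graph T \<and> (\<nexists>p. graph_cycle T p)"

definition locally_finite_graph :: "'v rooted_graph \<Rightarrow> bool" where
  "locally_finite_graph T \<longleftrightarrow> (\<forall>v\<in>verts T. finite {w. adjacent T v w})"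

definition graph_dist :: "'v rooted_graph \<Rightarrow> 'v \<Rightarrow> 'v \<Rightarrow> nat" where
  "graph_dist T u v = (LEAST k. \<exists>p. walk T p \<and> hd p = u \<and> last p = v \<and> length p = Suc k)"

definition level :: "'v rooted_graph \<Rightarrow> nat \<Rightarrow> 'v set" where
  "level T n = {v \<in> verts T. graph_dist T (root_vertex T) v = n}"

definition boundary :: "'v rooted_graph \<Rightarrow> (nat \<Rightarrow> 'v) set" where
  "boundary T = {r. r 0 = root_vertex T \<and>
                    (\<forall>n. adjacent T (r n) (r (Suc n))) \<and>
                    (\<forall>n. r (Suc (Suc n)) \<noteq> r n)}"

definition cylinder :: "'v rooted_graph \<Rightarrow> 'v \<Rightarrow> (nat \<Rightarrow> 'v) set" where
  "cylinder T v = {r \<in> boundary T. v \<in> range r}"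

definition boundary_topology :: "'v rooted_graph \<Rightarrow> (nat \<Rightarrow> 'v) topology" where
  "boundary_topology T = topology_generated_by (cylinder T ` verts T)"

definition rooted_automorphism :: "'v rooted_graph \<Rightarrow> ('v \<Rightarrow> 'v) \<Rightarrow> bool" where
  "rooted_automorphism T f \<longleftrightarrow>
     bij_betw f (verts T) (verts T) \<and>
     (\<forall>u\<in>verts T. \<forall>v\<in>verts T. adjacent T (f u) (f v) \<longleftrightarrow> adjacent T u v) \<and>
     f (root_vertex T) = root_vertex T"

text \<open>The restriction to the boundary is needed because \<^locale>\<open>group_action\<close> works with
  extensional functions; likewise in the action on the tree below.\<close>

definition induced_boundary_action ::
    "'v rooted_graph \<Rightarrow> ('g \<Rightarrow> 'v \<Rightarrow> 'v) \<Rightarrow> 'g \<Rightarrow> (nat \<Rightarrow> 'v) \<Rightarrow> nat \<Rightarrow> 'v" where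
  "induced_boundary_action T \<psi> g = (\<lambda>r \<in> boundary T. \<lambda>n. \<psi> g (r n))"


section \<open>The tree of an overlap function\<close>

text \<open>A vertex is a pair of a level and a class, which keeps classes at different levels
  distinct even when they coincide as subsets. Since \<open>c \<ge> 0\<close>, the only class at level 0
  of a nonempty \<open>S\<close> is \<open>S\<close> itself, so \<open>(0, S)\<close> is the root.\<close>

definition overlap_tree :: "'a set \<Rightarrow> ('a \<Rightarrow> 'a \<Rightarrow> enat) \<Rightarrow> (nat \<times> 'a set) rooted_graph" where
  "overlap_tree S c =
     \<lparr>verts = (SIGMA n:UNIV. S // overlap_rel S c n),
      edges = {{(n, C), (Suc n, D)} | n C D.
                 C \<in> S // overlap_rel S c n \<and> D \<in> S // overlap_rel S c (Suc n) \<and> D \<subseteq> C},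
      root_vertex = (0, S)\<rparr>"

definition boundary_map :: "'a set \<Rightarrow> ('a \<Rightarrow> 'a \<Rightarrow> enat) \<Rightarrow> 'a \<Rightarrow> nat \<Rightarrow> nat \<times> 'a set" where
  "boundary_map S c \<xi> = (\<lambda>n. (n, overlap_rel S c n `` {\<xi>}))"

text \<open>For an action preserving \<open>c\<close>, the image of the class of \<open>\<xi>\<close> under \<open>g\<close> is the class
  of \<open>g\<xi>\<close>.\<close>

definition tree_action ::
    "'a set \<Rightarrow> ('a \<Rightarrow> 'a \<Rightarrow> enat) \<Rightarrow> ('g \<Rightarrow> 'a \<Rightarrow> 'a) \<Rightarrow> 'g \<Rightarrow> nat \<times> 'a set \<Rightarrow> nat \<times> 'a set" where
  "tree_action S c \<phi> g = (\<lambda>v \<in> verts (overlap_tree S c). (fst v, \<phi> g ` snd v))"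

end

theory Submission
  imports Defs "HOL-Analysis.T1_Spaces"
begin

text \<open>A cycle in \<open>T\<^sub>c\<close> would contain a vertex of maximal level, whose two neighbours on the cycle
  would both be its unique parent; hence \<open>T\<^sub>c\<close> is a tree. Non-backtracking rays from the root can
  never turn back, so a ray is a nested sequence of classes. By compactness such a sequence has a
  common point, and admissibility makes this point unique, so \<open>\<pi>\<^sub>c\<close> is a bijection. The preimage of
  a cylinder is a class, which is open, and distinct rays are separated by cylinders; thus \<open>\<pi>\<^sub>c\<close> is
  a continuous bijection from a compact space onto a Hausdorff space. An action preserving \<open>c\<close>
  permutes the classes of each level and preserves containment.\<close>

section \<open>Walks, cycles and rays in rooted graphs\<close>

lemma walk_rev: "walk T (rev p) \<longleftrightarrow> walk T p"
  by (simp add: walk_def insert_commute)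

lemma walk_append_tl:
  assumes "walk T p" "walk T q" "last p = hd q"
  shows "walk T (p @ tl q)" "hd (p @ tl q) = hd p" "last (p @ tl q) = last q"
  using assms
  by (cases q; auto simp: walk_def successively_append_iff successively_Cons)+

text \<open>Adjacency is symmetric, so a walk from the root to \<open>u\<close> can be reversed and
  then continued by a walk from the root to \<open>v\<close>.\<close>

lemma connected_graph_if_root_reaches:
  assumes "\<And>v. v \<in> verts T \<Longrightarrow> \<exists>p. walk T p \<and> hd p = root_vertex T \<and> last p = v"
  shows "connected_graph T"
  unfolding connected_graph_def
proof (intro ballI)
  fix u v assume "u \<in> verts T" "v \<in> verts T"
  then obtain p q where p: "walk T p" "hd p = root_vertex T" "last p = u"
    and q: "walk T q" "hd q = root_vertex T" "last q = v"
    using assms by meson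
  have "last (rev p) = hd q" "hd (rev p) = u"
    using p q by (simp_all add: last_rev hd_rev)
  with p q show "\<exists>p. walk T p \<and> hd p = u \<and> last p = v"
    by (metis walk_append_tl walk_rev)
qed

text \<open>\<open>h\<close> stands for the level. It is maximised over the finitely many vertices
  of the cycle only, so it may be unbounded on the graph.\<close>

lemma no_graph_cycle_if_unique_parent:
  fixes h :: "'v \<Rightarrow> nat"
  assumes neq: "\<And>u v. adjacent T u v \<Longrightarrow> h u \<noteq> h v"
    and parent: "\<And>u v w. \<lbrakk>adjacent T u w; adjacent T v w; h u < h w; h v < h w\<rbrakk> \<Longrightarrow> u = v"
  shows "\<not> graph_cycle T p"
proof
  assume cyc: "graph_cycle T p"
  define n where "n = length p"
  have n: "3 \<le> n" and "distinct p" and "walk T p" and close: "adjacent T (last p) (hd p)"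
    using cyc by (auto simp: graph_cycle_def n_def)
  \<comment> \<open>Indices modulo \<open>n\<close> treat the closing edge like all the
    others.\<close>
  have adj: "adjacent T (p ! j) (p ! (Suc j mod n))" if "j < n" for j
  proof (cases "Suc j = n")
    case True
    then have "p ! j = last p" "p ! (Suc j mod n) = hd p"
    proof -
      have "p \<noteq> []" "j = length p - 1" "Suc j mod n = 0"
        using n True by (auto simp: n_def)
      then show "p ! j = last p" "p ! (Suc j mod n) = hd p"
        by (metis last_conv_nth, metis hd_conv_nth)
    qed
    with close show ?thesis by simp
  next
    case False
    with that \<open>walk T p\<close> show ?thesis
      by (simp add: walk_def n_def successively_conv_nth)
  qed
  define M where "M = Max (h ` set p)"
  have "M \<in> h ` set p"
    unfolding M_def using n by (intro Max_in) (auto simp: n_def)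
  then obtain i where i: "i < n" "h (p ! i) = M"
    by (auto simp: n_def in_set_conv_nth)
  have below: "h (p ! j) \<le> h (p ! i)" if "j < n" for j
    using that unfolding i(2) M_def by (intro Max_ge) (auto simp: n_def)
  \<comment> \<open>\<open>k\<close> and \<open>l\<close> are the cyclic predecessor and successor
    of \<open>i\<close>.\<close>
  define k where "k = (if i = 0 then n - 1 else i - 1)"
  define l where "l = Suc i mod n"
  have k: "k < n" "Suc k mod n = i" and l: "l < n"
    using n i by (auto simp: k_def l_def)
  \<comment> \<open>The two neighbours are distinct because \<open>n\<close> is at least 3; for
    \<open>n = 2\<close> they would coincide.\<close>
  have "k \<noteq> l"
    using n i by (cases "Suc i = n") (auto simp: k_def l_def)
  have kadj: "adjacent T (p ! k) (p ! i)"
    using adj[OF k(1)] k(2) by simp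
  have ladj: "adjacent T (p ! l) (p ! i)"
    using adj[OF i(1)] by (simp add: l_def insert_commute)
  \<comment> \<open>Maximality gives weak inequalities; they are strict because adjacent vertices
    differ in height.\<close>
  have "h (p ! k) < h (p ! i)" "h (p ! l) < h (p ! i)"
    using neq[OF kadj] neq[OF ladj] below[OF k(1)] below[OF l] by linarith+
  with kadj ladj have "p ! k = p ! l"
    by (rule parent)
  with \<open>k \<noteq> l\<close> \<open>distinct p\<close> k(1) l show False
    by (simp add: n_def nth_eq_iff_index_eq)
qed

lemma boundary_in_verts:
  assumes "simple_graph T" "r \<in> boundary T"
  shows "r n \<in> verts T"
proof -
  have "adjacent T (r n) (r (Suc n))"
    using assms(2) by (simp add: boundary_def)
  then show ?thesis
    using assms(1) unfolding simple_graph_def by (metis insertI1 insertE singletonD)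
qed

lemma rooted_automorphism_boundary:
  assumes "simple_graph T" "rooted_automorphism T f" "r \<in> boundary T"
  shows "(\<lambda>n. f (r n)) \<in> boundary T"
proof -
  have v: "r n \<in> verts T" for n
    using assms by (simp add: boundary_in_verts)
  \<comment> \<open>Injectivity is what carries the non-backtracking condition over to the image
    ray.\<close>
  have "inj_on f (verts T)"
    using assms(2) by (simp add: rooted_automorphism_def bij_betw_def)
  then show ?thesis
    using assms(2,3) v by (auto simp: boundary_def rooted_automorphism_def inj_on_eq_iff)
qed

section \<open>Group actions\<close>

text \<open>The pointwise laws suffice: the map of \<open>inv g\<close> is a two-sided inverse of
  that of \<open>g\<close>, and extensionality turns the pointwise product law into an equality of
  functions.\<close>

lemma group_actionI:
  fixes G (structure)
  assumes "group G"
    and ext: "\<And>g. g \<in> carrier G \<Longrightarrow> \<phi> g \<in> extensional E"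
    and closed: "\<And>g x. \<lbrakk>g \<in> carrier G; x \<in> E\<rbrakk> \<Longrightarrow> \<phi> g x \<in> E"
    and one: "\<And>x. x \<in> E \<Longrightarrow> \<phi> \<one> x = x"
    and mult: "\<And>g h x. \<lbrakk>g \<in> carrier G; h \<in> carrier G; x \<in> E\<rbrakk> \<Longrightarrow> \<phi> (g \<otimes> h) x = \<phi> g (\<phi> h x)"
  shows "group_action G E \<phi>"
proof -
  interpret group G by fact
  have bij: "\<phi> g \<in> Bij E" if g: "g \<in> carrier G" for g
  proof -
    have "bij_betw (\<phi> g) E E"
    proof (rule bij_betw_byWitness[where f' = "\<phi> (inv g)"])
      show "\<forall>x\<in>E. \<phi> (inv g) (\<phi> g x) = x"
        using mult[of "inv g" g] one g by simp
      show "\<forall>x\<in>E. \<phi> g (\<phi> (inv g) x) = x"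
        using mult[of g "inv g"] one g by simp
    qed (use closed g in auto)
    with ext[OF g] show ?thesis by (simp add: Bij_def)
  qed
  have "\<phi> (g \<otimes> h) = compose E (\<phi> g) (\<phi> h)" if "g \<in> carrier G" "h \<in> carrier G" for g h
    using that by (intro extensionalityI[of _ E]) (auto simp: ext mult compose_eq)
  then have "\<phi> \<in> hom G (BijGroup E)"
    using bij by (auto simp: hom_def BijGroup_def)
  then show ?thesis
    by (simp add: group_action_def group_hom_def group_hom_axioms_def group_BijGroup \<open>group G\<close>)
qed

lemma (in group_action) one_action: "x \<in> E \<Longrightarrow> \<phi> \<one> x = x"
  by (metis id_eq_one restrict_apply')

lemma group_action_induced_boundary:
  fixes G (structure)
  assumes act: "group_action G (verts T) \<psi>" and "simple_graph T"
    and aut: "\<And>g. g \<in> carrier G \<Longrightarrow> rooted_automorphism T (\<psi> g)"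
  shows "group_action G (boundary T) (induced_boundary_action T \<psi>)"
proof -
  interpret group_action G "verts T" \<psi> by fact
  interpret group G
    using group_hom by (rule group_hom.axioms(1))
  have v: "r n \<in> verts T" if "r \<in> boundary T" for r n
    using boundary_in_verts[OF \<open>simple_graph T\<close> that] .
  have closed: "(\<lambda>n. \<psi> g (r n)) \<in> boundary T" if "g \<in> carrier G" "r \<in> boundary T" for g r
    using rooted_automorphism_boundary \<open>simple_graph T\<close> aut that by blast
  show ?thesis
  proof (rule group_actionI)
    show "group G" by (rule is_group)
  qed (simp_all add: induced_boundary_action_def closed v one_action composition_rule)
qed

section \<open>The tree of an overlap function\<close>

locale overlap =
  fixes S :: "'a set" and c :: "'a \<Rightarrow> 'a \<Rightarrow> enat"
  assumes overlap: "overlap_function S c"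
begin

abbreviation R :: "nat \<Rightarrow> 'a rel" where
  "R \<equiv> overlap_rel S c"

abbreviation tree :: "(nat \<times> 'a set) rooted_graph" where
  "tree \<equiv> overlap_tree S c"

section \<open>Classes of the relations and their nesting\<close>

lemma equiv_overlap_rel: "equiv S (R n)"
proof (rule equivI)
  show "refl_on S (R n)"
    using overlap by (auto simp: overlap_function_def overlap_rel_def refl_on_def)
  show "sym (R n)"
    using overlap by (auto simp: overlap_function_def overlap_rel_def sym_def)
  \<comment> \<open>Transitivity is the ultrametric inequality for \<open>c\<close>.\<close>
  show "trans (R n)"
  proof (rule transI)
    fix x y z assume "(x, y) \<in> R n" "(y, z) \<in> R n"
    then have *: "x \<in> S" "y \<in> S" "z \<in> S" "enat n \<le> min (c x y) (c y z)"
      by (auto simp: overlap_rel_def)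
    moreover have "min (c x y) (c y z) \<le> c x z"
      using overlap * by (auto simp: overlap_function_def)
    ultimately have "enat n \<le> c x z"
      by (meson order_trans)
    with * show "(x, z) \<in> R n"
      by (simp add: overlap_rel_def)
  qed
qed (auto simp: overlap_rel_def)

lemma class_eq: "\<lbrakk>C \<in> S // R n; x \<in> C\<rbrakk> \<Longrightarrow> C = R n `` {x}"
  by (metis Image_singleton_iff equiv_class_eq equiv_overlap_rel quotientE)

lemma class_subset: "C \<in> S // R n \<Longrightarrow> C \<subseteq> S"
  by (metis Union_quotient Union_upper equiv_overlap_rel)

lemma class_nonempty: "C \<in> S // R n \<Longrightarrow> C \<noteq> {}"
  by (rule in_quotient_imp_non_empty[OF equiv_overlap_rel])

lemma self_in_class: "x \<in> S \<Longrightarrow> x \<in> R n `` {x}"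
  by (rule equiv_class_self[OF equiv_overlap_rel])

lemma class_zero: "x \<in> S \<Longrightarrow> R 0 `` {x} = S"
  by (auto simp: overlap_rel_def simp flip: zero_enat_def)

lemma class_Suc_subset: "R (Suc n) `` {x} \<subseteq> R n `` {x}"
proof -
  have "enat n \<le> c x y" if "enat (Suc n) \<le> c x y" for y
    by (rule order_trans[OF _ that]) simp
  then show ?thesis
    by (auto simp: overlap_rel_def)
qed

text \<open>A point of the nonempty class \<open>D\<close> lies in both \<open>C\<close> and
  \<open>C'\<close>, and classes of one level are disjoint or equal. This is the uniqueness of
  parents in the tree.\<close>

lemma class_super_unique:
  assumes "C \<in> S // R n" "C' \<in> S // R n" "D \<in> S // R m" "D \<subseteq> C" "D \<subseteq> C'"
  shows "C = C'"
proof -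
  obtain x where "x \<in> D"
    using class_nonempty[OF assms(3)] by blast
  with assms show ?thesis
    by (metis class_eq subsetD)
qed

section \<open>Vertices and edges of the tree\<close>

lemma verts_tree: "(n, C) \<in> verts tree \<longleftrightarrow> C \<in> S // R n"
  by (simp add: overlap_tree_def)

lemma root_tree: "root_vertex tree = (0, S)"
  by (simp add: overlap_tree_def)

text \<open>Edges are unordered, so either endpoint may be the parent; hence the
  disjunction.\<close>

lemma adjacent_tree:
  "adjacent tree (m, C) (n, D) \<longleftrightarrow>
    C \<in> S // R m \<and> D \<in> S // R n \<and> (n = Suc m \<and> D \<subseteq> C \<or> m = Suc n \<and> C \<subseteq> D)"
  by (auto simp: overlap_tree_def doubleton_eq_iff)

lemma adjacent_tree_SucI:
  "\<lbrakk>C \<in> S // R n; D \<in> S // R (Suc n); D \<subseteq> C\<rbrakk> \<Longrightarrow> adjacent tree (n, C) (Suc n, D)"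
  by (simp add: adjacent_tree)

lemma simple_graph_tree: "simple_graph tree"
  unfolding simple_graph_def
proof
  fix e assume "e \<in> edges tree"
  then obtain n C D where "e = {(n, C), (Suc n, D)}" "C \<in> S // R n" "D \<in> S // R (Suc n)"
    by (auto simp: overlap_tree_def)
  then show "\<exists>u\<in>verts tree. \<exists>v\<in>verts tree. u \<noteq> v \<and> e = {u, v}"
    by (intro bexI[of _ "(n, C)"] bexI[of _ "(Suc n, D)"]) (simp_all add: verts_tree)
qed

section \<open>Rays of points, and connectedness of the tree\<close>

lemma boundary_map_vert: "x \<in> S \<Longrightarrow> boundary_map S c x n \<in> verts tree"
  by (simp add: boundary_map_def verts_tree quotientI)

lemma boundary_map_adjacent:
  "x \<in> S \<Longrightarrow> adjacent tree (boundary_map S c x n) (boundary_map S c x (Suc n))"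
  unfolding boundary_map_def by (intro adjacent_tree_SucI quotientI class_Suc_subset)

lemma boundary_map_zero: "x \<in> S \<Longrightarrow> boundary_map S c x 0 = (0, S)"
  by (simp add: boundary_map_def class_zero)

lemma boundary_map_in_boundary: "x \<in> S \<Longrightarrow> boundary_map S c x \<in> boundary tree"
  using boundary_map_adjacent boundary_map_zero
  by (simp add: boundary_def root_tree) (simp add: boundary_map_def)

text \<open>Any point of \<open>C\<close> provides the walk: the first \<open>Suc n\<close> vertices
  of its ray end at \<open>(n, C)\<close>. The exact length bounds the distance from the root
  above.\<close>

lemma walk_from_root:
  assumes "(n, C) \<in> verts tree"
  shows "\<exists>p. walk tree p \<and> hd p = root_vertex tree \<and> last p = (n, C) \<and> length p = Suc n"
proof -
  have C: "C \<in> S // R n"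
    using assms by (simp add: verts_tree)
  then obtain x where x: "x \<in> C"
    using class_nonempty by blast
  then have xS: "x \<in> S"
    using class_subset[OF C] by blast
  let ?p = "map (boundary_map S c x) [0..<Suc n]"
  have "walk tree ?p"
    unfolding walk_def
    using boundary_map_vert[OF xS] boundary_map_adjacent[OF xS]
    by (auto simp: successively_conv_nth simp del: upt_Suc)
  moreover have "hd ?p = root_vertex tree"
    by (simp add: hd_map root_tree boundary_map_zero[OF xS] del: upt_Suc)
  moreover have "last ?p = (n, C)"
    using class_eq[OF C x] by (simp add: boundary_map_def)
  moreover have "length ?p = Suc n" by simp
  ultimately show ?thesis by blast
qed

lemma rooted_tree_overlap_tree:
  assumes "S \<noteq> {}"
  shows "rooted_tree tree"
proof -
  obtain x where "x \<in> S"
    using assms by blast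
  then have "root_vertex tree \<in> verts tree"
    using boundary_map_vert[of x 0] by (simp add: root_tree boundary_map_zero)
  moreover have "connected_graph tree"
    by (rule connected_graph_if_root_reaches) (metis surj_pair walk_from_root)
  moreover have "\<not> graph_cycle tree p" for p
  proof (rule no_graph_cycle_if_unique_parent[where h = fst])
    fix u v assume "adjacent tree u v"
    then show "fst u \<noteq> fst v"
      by (cases u; cases v) (auto simp: adjacent_tree)
  next
    fix u v w assume "adjacent tree u w" "adjacent tree v w" "fst u < fst w" "fst v < fst w"
    then show "u = v"
      by (cases u; cases v; cases w) (auto simp: adjacent_tree dest: class_super_unique)
  qed
  ultimately show ?thesis
    by (simp add: rooted_tree_def simple_graph_tree)
qed

section \<open>Local finiteness, and levels as distances from the root\<close>

lemma locally_finite_tree: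
  assumes "\<And>n. finite (S // R n)"
  shows "locally_finite_graph tree"
  unfolding locally_finite_graph_def
proof
  fix v assume "v \<in> verts tree"
  obtain n C where v: "v = (n, C)" by (cases v)
  \<comment> \<open>Neighbours of \<open>v\<close> lie in levels at most \<open>Suc n\<close>, of
    which there are finitely many, each finite.\<close>
  have "{w. adjacent tree v w} \<subseteq> (SIGMA m:{..Suc n}. S // R m)"
    by (auto simp: v adjacent_tree)
  then show "finite {w. adjacent tree v w}"
    by (rule finite_subset) (intro finite_SigmaI finite_atMost assms)
qed

text \<open>An edge raises the level by at most one, and a walk has one edge fewer than vertices;
  hence the strict inequality. Starting at the root, this bounds the distance below.\<close>

lemma walk_height:
  assumes "walk tree p"
  shows "fst (last p) < fst (hd p) + length p"
  using assms
proof (induction p rule: induct_list012)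
  case (3 u v p)
  then have "adjacent tree u v" and "walk tree (v # p)"
    by (auto simp: walk_def)
  moreover from \<open>adjacent tree u v\<close> have "fst v \<le> Suc (fst u)"
    by (cases u; cases v) (auto simp: adjacent_tree)
  ultimately show ?case
    using "3.IH"(2) by simp
qed (auto simp: walk_def)

lemma graph_dist_root:
  assumes "(n, C) \<in> verts tree"
  shows "graph_dist tree (root_vertex tree) (n, C) = n"
  unfolding graph_dist_def
proof (rule Least_equality)
  show "\<exists>p. walk tree p \<and> hd p = root_vertex tree \<and> last p = (n, C) \<and> length p = Suc n"
    using walk_from_root[OF assms] .
next
  fix k assume "\<exists>p. walk tree p \<and> hd p = root_vertex tree \<and> last p = (n, C) \<and> length p = Suc k"
  then show "n \<le> k"
    using walk_height by (fastforce simp: root_tree)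
qed

lemma level_tree: "level tree n = {n} \<times> (S // R n)"
  by (auto simp: level_def graph_dist_root verts_tree)

section \<open>The boundary map\<close>

text \<open>Every step changes the level by one. A first step down would follow a step up and lead
  back to the unique parent, which is backtracking.\<close>

lemma boundary_tree_height:
  assumes "r \<in> boundary tree"
  shows "fst (r n) = n"
proof -
  have adj: "adjacent tree (r n) (r (Suc n))" for n
    using assms by (simp add: boundary_def)
  have step: "fst (r (Suc n)) = Suc (fst (r n)) \<or> fst (r n) = Suc (fst (r (Suc n)))" for n
    using adj[of n] by (cases "r n"; cases "r (Suc n)") (auto simp: adjacent_tree)
  \<comment> \<open>Two consecutive levels are carried through the induction, since excluding a step
    down requires that the step before went up.\<close>
  have "fst (r n) = n \<and> fst (r (Suc n)) = Suc n"
  proof (induction n)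
    case 0
    have "fst (r 0) = 0"
      using assms by (simp add: boundary_def root_tree)
    with step[of 0] show ?case by simp
  next
    case (Suc n)
    have "fst (r (Suc (Suc n))) \<noteq> n"
    proof
      assume down: "fst (r (Suc (Suc n))) = n"
      obtain C D E where "r n = (n, C)" "r (Suc n) = (Suc n, D)" "r (Suc (Suc n)) = (n, E)"
        using Suc down by (metis prod.collapse)
      then have "r (Suc (Suc n)) = r n"
        using adj[of n] adj[of "Suc n"] by (auto simp: adjacent_tree dest: class_super_unique)
      with assms show False
        by (simp add: boundary_def)
    qed
    with Suc step[of "Suc n"] show ?case by auto
  qed
  then show ?thesis ..
qed

lemma boundary_tree_nested:
  assumes "r \<in> boundary tree"
  shows "r n = (n, snd (r n))" "snd (r n) \<in> S // R n" "snd (r (Suc n)) \<subseteq> snd (r n)"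
proof -
  have r: "r n = (n, snd (r n))" for n
    using boundary_tree_height[OF assms, of n] by (metis prod.collapse)
  then show "r n = (n, snd (r n))" .
  have "adjacent tree (n, snd (r n)) (Suc n, snd (r (Suc n)))"
    using assms r[of n] r[of "Suc n"] by (simp add: boundary_def)
  then show "snd (r n) \<in> S // R n" "snd (r (Suc n)) \<subseteq> snd (r n)"
    by (simp_all add: adjacent_tree)
qed

section \<open>Cylinders and the boundary topology\<close>

lemma cylinder_tree: "cylinder tree (n, C) = {r \<in> boundary tree. r n = (n, C)}"
proof -
  \<comment> \<open>A ray meets level \<open>n\<close> at index \<open>n\<close> only, so
    \<open>k = n\<close>.\<close>
  have "r n = (n, C)" if "r \<in> boundary tree" "r k = (n, C)" for r k
    using boundary_tree_height[OF that(1), of k] that(2) by simp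
  then show ?thesis
    unfolding cylinder_def by (auto simp: image_iff) metis
qed

lemma boundary_map_vimage_cylinder:
  assumes "C \<in> S // R n"
  shows "boundary_map S c -` cylinder tree (n, C) \<inter> S = C"
  using class_eq[OF assms] class_subset[OF assms] self_in_class boundary_map_in_boundary
  by (auto simp: cylinder_tree boundary_map_def)

text \<open>A generated topology has the union of its generators as underlying set, so this
  identifies the points of \<open>boundary_topology tree\<close>.\<close>

lemma Union_cylinders: "\<Union> (cylinder tree ` verts tree) = boundary tree"
proof
  show "boundary tree \<subseteq> \<Union> (cylinder tree ` verts tree)"
    using boundary_in_verts[OF simple_graph_tree] by (auto simp: cylinder_def)
qed (auto simp: cylinder_def)

lemma topspace_boundary_tree: "topspace (boundary_topology tree) = boundary tree"
  by (simp add: boundary_topology_def Union_cylinders)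

text \<open>Rays that differ at index \<open>n\<close> pass through different vertices of level
  \<open>n\<close>, and the cylinders of these are disjoint.\<close>

lemma Hausdorff_boundary_tree: "Hausdorff_space (boundary_topology tree)"
  unfolding Hausdorff_space_def topspace_boundary_tree
proof (intro allI impI, elim conjE)
  fix r s assume r: "r \<in> boundary tree" and s: "s \<in> boundary tree" and "r \<noteq> s"
  then obtain n where n: "r n \<noteq> s n" by blast
  have op: "openin (boundary_topology tree) (cylinder tree (q n))" if "q \<in> boundary tree" for q
    unfolding boundary_topology_def
    using that boundary_in_verts[OF simple_graph_tree] by (intro topology_generated_by_Basis) blast
  have cyl: "cylinder tree (q n) = {t \<in> boundary tree. t n = q n}" if "q \<in> boundary tree" for q
    using cylinder_tree[of n "snd (q n)"] boundary_tree_nested(1)[OF that, of n] by simp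
  show "\<exists>U V. openin (boundary_topology tree) U \<and> openin (boundary_topology tree) V \<and>
      r \<in> U \<and> s \<in> V \<and> disjnt U V"
    using op[OF r] op[OF s] cyl[OF r] cyl[OF s] r s n
    by (intro exI[of _ "cylinder tree (r n)"] exI[of _ "cylinder tree (s n)"])
      (auto simp: disjnt_def)
qed

lemma homeomorphic_boundary_map:
  assumes S: "S = topspace X" and "compact_space X" and adm: "admissible X c"
  shows "homeomorphic_map X (boundary_topology tree) (boundary_map S c)"
proof (rule continuous_imp_homeomorphic_map)
  have clopen: "openin X C" "closedin X C" if "C \<in> S // R n" for C n
    using adm that by (auto simp: admissible_def S)
  show "compact_space X" by fact
  show "Hausdorff_space (boundary_topology tree)"
    by (rule Hausdorff_boundary_tree)
  show "continuous_map X (boundary_topology tree) (boundary_map S c)"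
    unfolding boundary_topology_def
  proof (rule continuous_on_generated_topo)
    fix U assume "U \<in> cylinder tree ` verts tree"
    then obtain n C where "U = cylinder tree (n, C)" "C \<in> S // R n"
      by (auto simp: verts_tree)
    then show "openin X (boundary_map S c -` U \<inter> topspace X)"
      using boundary_map_vimage_cylinder clopen by (simp flip: S)
  next
    show "boundary_map S c ` topspace X \<subseteq> \<Union> (cylinder tree ` verts tree)"
      unfolding Union_cylinders by (auto simp: boundary_map_in_boundary simp flip: S)
  qed
  show "inj_on (boundary_map S c) (topspace X)"
  proof (rule inj_onI)
    fix x y assume xy: "x \<in> topspace X" "y \<in> topspace X"
      and eq: "boundary_map S c x = boundary_map S c y"
    \<comment> \<open>Equal rays put \<open>x\<close> and \<open>y\<close> into one class at every
      level, which forces infinite overlap.\<close>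
    have "enat n \<le> c x y" for n
    proof -
      have "R n `` {x} = R n `` {y}"
        using fun_cong[OF eq, of n] by (simp add: boundary_map_def)
      then have "y \<in> R n `` {x}"
        using self_in_class[of y n] xy S by simp
      then show ?thesis
        by (simp add: overlap_rel_def)
    qed
    then have "c x y = \<infinity>"
      by (metis enat.exhaust enat_ord_simps(1) infinity_enat_def not_less_eq_eq order_refl)
    with adm xy show "x = y"
      by (simp add: admissible_def)
  qed
  show "boundary_map S c ` topspace X = topspace (boundary_topology tree)"
    unfolding topspace_boundary_tree S[symmetric]
  proof
    show "boundary tree \<subseteq> boundary_map S c ` S"
    proof
      fix r assume r: "r \<in> boundary tree"
      note nested = boundary_tree_nested[OF r]
      \<comment> \<open>The classes along the ray are nonempty, nested and, by admissibility,
        closed, so compactness yields a common point.\<close>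
      have "(\<Inter>n. snd (r n)) \<noteq> {}"
        using \<open>compact_space X\<close>
      proof (rule compact_space_imp_nest)
        show "decseq (\<lambda>n. snd (r n))"
          using nested(3) by (intro decseq_SucI)
      qed (use nested(2) clopen class_nonempty in blast)+
      then obtain x where x: "\<And>n. x \<in> snd (r n)" by blast
      \<comment> \<open>A class containing \<open>x\<close> is the class of \<open>x\<close>, so the
        ray of \<open>x\<close> is \<open>r\<close>.\<close>
      have "r n = boundary_map S c x n" for n
        using nested(1)[of n] class_eq[OF nested(2) x] by (simp add: boundary_map_def)
      moreover have "x \<in> S"
        using x nested(2) class_subset by blast
      ultimately show "r \<in> boundary_map S c ` S" by blast
    qed
  qed (auto simp: boundary_map_in_boundary)
qed

end

section \<open>Actions preserving the overlap function\<close>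

locale overlap_action = overlap S c + group_action G S \<phi>
  for S :: "'a set" and c :: "'a \<Rightarrow> 'a \<Rightarrow> enat" and G (structure) and \<phi> +
  assumes invariant: "\<lbrakk>g \<in> carrier G; x \<in> S; y \<in> S\<rbrakk> \<Longrightarrow> c (\<phi> g x) (\<phi> g y) = c x y"
begin

text \<open>Invariance gives one inclusion; for the other, surjectivity of \<open>\<phi> g\<close>
  on \<open>S\<close> supplies a preimage, which invariance places in the class of
  \<open>x\<close>.\<close>

lemma image_class:
  assumes g: "g \<in> carrier G" and x: "x \<in> S"
  shows "\<phi> g ` (R n `` {x}) = R n `` {\<phi> g x}"
proof
  show "\<phi> g ` (R n `` {x}) \<subseteq> R n `` {\<phi> g x}"
    using element_image[OF g] invariant[OF g] by (auto simp: overlap_rel_def)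
  show "R n `` {\<phi> g x} \<subseteq> \<phi> g ` (R n `` {x})"
  proof
    fix y assume y: "y \<in> R n `` {\<phi> g x}"
    then have "y \<in> \<phi> g ` S"
      using surj_prop[OF g] by (auto simp: overlap_rel_def)
    then obtain z where "z \<in> S" "y = \<phi> g z" by blast
    with y show "y \<in> \<phi> g ` (R n `` {x})"
      using invariant[OF g x] x by (auto simp: overlap_rel_def)
  qed
qed

lemma image_class_in_quotient:
  assumes "g \<in> carrier G" "C \<in> S // R n"
  shows "\<phi> g ` C \<in> S // R n"
  using assms(2)
proof (rule quotientE)
  fix x assume "C = R n `` {x}" "x \<in> S"
  with assms(1) show ?thesis
    by (simp add: image_class quotientI element_image)
qed

lemma tree_action_vert: "C \<in> S // R n \<Longrightarrow> tree_action S c \<phi> g (n, C) = (n, \<phi> g ` C)"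
  by (simp add: tree_action_def verts_tree)

lemma tree_action_class:
  assumes "g \<in> carrier G" "x \<in> S"
  shows "tree_action S c \<phi> g (n, R n `` {x}) = (n, R n `` {\<phi> g x})"
  using assms by (simp add: tree_action_vert quotientI image_class)

lemma group_action_tree: "group_action G (verts tree) (tree_action S c \<phi>)"
proof (rule group_actionI)
  show "group G"
    using group_hom by (rule group_hom.axioms(1))
  show "tree_action S c \<phi> g \<in> extensional (verts tree)" for g
    by (simp add: tree_action_def)
next
  fix g v assume "g \<in> carrier G" "v \<in> verts tree"
  then show "tree_action S c \<phi> g v \<in> verts tree"
    by (cases v) (simp add: verts_tree tree_action_vert image_class_in_quotient)
next
  fix v assume "v \<in> verts tree"
  moreover have "\<phi> \<one> ` C = C" if "C \<subseteq> S" for C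
    using that one_action by (force simp: image_iff)
  ultimately show "tree_action S c \<phi> \<one> v = v"
    by (cases v) (simp add: verts_tree tree_action_vert class_subset)
next
  fix g h v assume gh: "g \<in> carrier G" "h \<in> carrier G" and v: "v \<in> verts tree"
  have "\<phi> (g \<otimes> h) ` C = \<phi> g ` \<phi> h ` C" if "C \<subseteq> S" for C
    using that gh by (auto simp: image_image subset_iff composition_rule intro!: image_cong)
  with gh v show "tree_action S c \<phi> (g \<otimes> h) v = tree_action S c \<phi> g (tree_action S c \<phi> h v)"
    by (cases v) (simp add: verts_tree tree_action_vert class_subset image_class_in_quotient)
qed

lemma rooted_automorphism_tree_action:
  assumes "S \<noteq> {}" and g: "g \<in> carrier G"
  shows "rooted_automorphism tree (tree_action S c \<phi> g)"
  unfolding rooted_automorphism_def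
proof (intro conjI ballI)
  \<comment> \<open>Bijectivity comes with the group action on the vertices.\<close>
  show "bij_betw (tree_action S c \<phi> g) (verts tree) (verts tree)"
    using group_action.bij_prop0[OF group_action_tree g] by (simp add: Bij_def)
next
  fix u v assume "u \<in> verts tree" "v \<in> verts tree"
  \<comment> \<open>Since \<open>\<phi> g\<close> is injective on \<open>S\<close>, taking images
    also reflects inclusions, so adjacency is preserved in both directions.\<close>
  moreover have "\<phi> g ` C \<subseteq> \<phi> g ` D \<longleftrightarrow> C \<subseteq> D" if "C \<in> S // R m" "D \<in> S // R n" for C D m n
    using class_subset[OF that(1)] class_subset[OF that(2)]
    by (metis image_mono image_subset_iff inj_on_image_mem_iff inj_prop[OF g] subset_iff)
  ultimately show "adjacent tree (tree_action S c \<phi> g u) (tree_action S c \<phi> g v) \<longleftrightarrow> adjacent tree u v"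
    by (cases u; cases v)
      (auto simp: verts_tree tree_action_vert adjacent_tree image_class_in_quotient g)
next
  \<comment> \<open>The tree action is given by images on vertices only, so the root must first be
    known to be a vertex; this uses that \<open>S\<close> is nonempty.\<close>
  have "S \<in> S // R 0"
    using \<open>S \<noteq> {}\<close> by (metis class_zero equals0I quotientI)
  then show "tree_action S c \<phi> g (root_vertex tree) = root_vertex tree"
    by (simp add: root_tree tree_action_vert surj_prop[OF g])
qed

text \<open>At level \<open>n\<close> both sides are the class of \<open>\<phi> g x\<close>; the ray
  of \<open>x\<close> lies in the boundary, where the restricted induced action is given by its
  formula.\<close>

lemma boundary_map_equivariant:
  assumes "g \<in> carrier G" "x \<in> S"
  shows "boundary_map S c (\<phi> g x) =
    induced_boundary_action tree (tree_action S c \<phi>) g (boundary_map S c x)"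
  using assms boundary_map_in_boundary
  by (simp add: induced_boundary_action_def) (simp add: boundary_map_def tree_action_class)

end

theorem proposition3p7:
  fixes X :: "'a topology" and S :: "'a set" and c :: "'a \<Rightarrow> 'a \<Rightarrow> enat"
    and T :: "(nat \<times> 'a set) rooted_graph"
  assumes "S = topspace X"
    and "T = overlap_tree S c"
    and "S \<noteq> {}"
    and "compact_space X"
    and "totally_disconnected_space X"
    and "overlap_function S c"
    and "admissible X c"
  shows "rooted_tree T \<and>
    locally_finite_graph T \<and>
    (\<forall>n. level T n = {n} \<times> (S // overlap_rel S c n)) \<and>
    homeomorphic_map X (boundary_topology T) (boundary_map S c) \<and>
    (\<forall>(G :: ('g, 'm) monoid_scheme) \<phi>.
       group_action G S \<phi> \<and>
       (\<forall>g \<in> carrier G. \<forall>\<xi>\<in>S. \<forall>\<eta>\<in>S. c (\<phi> g \<xi>) (\<phi> g \<eta>) = c \<xi> \<eta>) \<longrightarrow>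
         (\<forall>g \<in> carrier G. \<forall>n. \<forall>\<xi>\<in>S.
            tree_action S c \<phi> g (n, overlap_rel S c n `` {\<xi>}) =
              (n, overlap_rel S c n `` {\<phi> g \<xi>})) \<and>
         group_action G (verts T) (tree_action S c \<phi>) \<and>
         (\<forall>g \<in> carrier G. rooted_automorphism T (tree_action S c \<phi> g)) \<and>
         group_action G (boundary T) (induced_boundary_action T (tree_action S c \<phi>)) \<and>
         (\<forall>g \<in> carrier G. \<forall>\<xi>\<in>S.
            boundary_map S c (\<phi> g \<xi>) =
              induced_boundary_action T (tree_action S c \<phi>) g (boundary_map S c \<xi>)))"
proof -
  note S = assms(1) and T = assms(2)
  interpret overlap S c
    using assms(6) by unfold_locales
  have "finite (S // overlap_rel S c n)" for n
    using assms(7) by (simp add: admissible_def S)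
  then have "locally_finite_graph T"
    unfolding T by (rule locally_finite_tree)
  moreover have "homeomorphic_map X (boundary_topology T) (boundary_map S c)"
    unfolding T using S assms(4,7) by (rule homeomorphic_boundary_map)
  moreover have "rooted_tree T" "\<forall>n. level T n = {n} \<times> (S // overlap_rel S c n)"
    unfolding T using assms(3) by (simp_all add: rooted_tree_overlap_tree level_tree)
  moreover have
    "(\<forall>g \<in> carrier G. \<forall>n. \<forall>\<xi>\<in>S.
        tree_action S c \<phi> g (n, overlap_rel S c n `` {\<xi>}) =
          (n, overlap_rel S c n `` {\<phi> g \<xi>})) \<and>
     group_action G (verts T) (tree_action S c \<phi>) \<and>
     (\<forall>g \<in> carrier G. rooted_automorphism T (tree_action S c \<phi> g)) \<and>
     group_action G (boundary T) (induced_boundary_action T (tree_action S c \<phi>)) \<and>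
     (\<forall>g \<in> carrier G. \<forall>\<xi>\<in>S.
        boundary_map S c (\<phi> g \<xi>) =
          induced_boundary_action T (tree_action S c \<phi>) g (boundary_map S c \<xi>))"
    if "group_action G S \<phi> \<and>
      (\<forall>g \<in> carrier G. \<forall>\<xi>\<in>S. \<forall>\<eta>\<in>S. c (\<phi> g \<xi>) (\<phi> g \<eta>) = c \<xi> \<eta>)"
    for G :: "('g, 'm) monoid_scheme" and \<phi>
  proof -
    \<comment> \<open>For this arbitrary invariant action, the conjuncts are results of the context,
      together with the general lemma on induced boundary actions.\<close>
    interpret overlap_action S c G \<phi>
      using that by (simp add: overlap_action_def overlap_action_axioms_def overlap_axioms)
    show ?thesis
      unfolding T
      by (intro conjI allI ballI tree_action_class group_action_tree boundary_map_equivariant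
          group_action_induced_boundary simple_graph_tree
          rooted_automorphism_tree_action assms(3))
  qed
  ultimately show ?thesis by blast
qed

end
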